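(* Let $f$ and $g$ be transcendental entire functions such that $CP(g\circ f)$ is bounded. Then $CP(f)$ is also bounded, and $g$ has at most one critical point, which (if it exists) is a Picard exceptional value of $f$.
   Context: For an entire function $h$, $CP(h)=\{z\in\mathbb{C}: h'(z)=0\}$ is the set of critical points of $h$. A Picard exceptional value of a transcendental entire function $h$ is a point $w\in\mathbb{C}$ such that $h(z)=w$ has at most finitely many solutions $z\in\mathbb{C}$. *)

theory Defs
  imports "HOL-Complex_Analysis.Complex_Analysis" "HOL-Computational_Algebra.Polynomial"
begin

(* Transcendental entire: entire, but not a polynomial function (constants included). *)
definition transcendental_entire :: "(complex \<Rightarrow> complex) \<Rightarrow> bool" where
  "transcendental_entire h \<longleftrightarrow>
     h holomorphic_on UNIV \<and> \<not> (\<exists>p :: complex poly. \<forall>z. h z = poly p z)"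

definition CP :: "(complex \<Rightarrow> complex) \<Rightarrow> complex set" where
  "CP h = {z. deriv h z = 0}"

(* Only meaningful for transcendental entire h; solutions are counted as points,
   which for finiteness is the same as counting them with multiplicity. *)
definition Picard_exceptional_value :: "(complex \<Rightarrow> complex) \<Rightarrow> complex \<Rightarrow> bool" where
  "Picard_exceptional_value h w \<longleftrightarrow> finite {z. h z = w}"

end

(* By the chain rule CP (g o f) is the union of CP f and the f-preimage of CP g, so both are
   bounded.  A bounded fibre of a nonconstant entire function is finite, hence every critical
   point of g is a Picard exceptional value of f; by the great Picard theorem at infinity, a
   transcendental entire function has at most one of these. *)
theory Submission
  imports Defs
begin

text \<open>Bridges two encodings of polynomials: \<open>pole_at_infinity\<close> yields a
  coefficient sum, while \<open>transcendental_entire\<close> speaks of \<open>poly\<close>.\<close>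

lemma transcendental_entire_not_polyfun:
  assumes "transcendental_entire f"
  shows "\<nexists>(a :: nat \<Rightarrow> complex) n. \<forall>z. f z = (\<Sum>i\<le>n. a i * z ^ i)"
proof
  assume "\<exists>(a :: nat \<Rightarrow> complex) n. \<forall>z. f z = (\<Sum>i\<le>n. a i * z ^ i)"
  then obtain a :: "nat \<Rightarrow> complex" and n where "\<forall>z. f z = (\<Sum>i\<le>n. a i * z ^ i)"
    by blast
  then have "\<forall>z. f z = poly (\<Sum>i\<le>n. monom (a i) i) z"
    by (simp add: poly_sum poly_monom)
  with assms show False
    unfolding transcendental_entire_def by blast
qed

lemma transcendental_entire_not_constant:
  assumes "transcendental_entire f"
  shows "\<not> f constant_on UNIV"
proof
  assume "f constant_on UNIV"
  then obtain c where "\<forall>z. f z = poly [:c:] z"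
    by (auto simp: constant_on_def)
  with assms show False
    unfolding transcendental_entire_def by blast
qed

text \<open>By Liouville: a finite limit at infinity would make \<open>f\<close> bounded, hence
  constant. This excludes a removable singularity at infinity.\<close>

lemma transcendental_entire_no_limit_at_infinity:
  assumes "transcendental_entire f"
  shows "\<not> (f \<longlongrightarrow> l) at_infinity"
proof
  assume "(f \<longlongrightarrow> l) at_infinity"
  moreover have "f holomorphic_on UNIV"
    using assms by (simp add: transcendental_entire_def)
  ultimately have "f constant_on UNIV"
    using Liouville_weak unfolding constant_on_def by blast
  with assms show False
    using transcendental_entire_not_constant by blast
qed

text \<open>Excludes a pole at infinity, the case \<open>l = 0\<close>, since an entire function
  with such a pole is a polynomial. Infinity is thus an essential singularity.\<close>

lemma transcendental_entire_inverse_no_limit_at_infinity: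
  assumes "transcendental_entire f"
  shows "\<not> ((inverse \<circ> f) \<longlongrightarrow> l) at_infinity"
proof
  assume "((inverse \<circ> f) \<longlongrightarrow> l) at_infinity"
  moreover have "f holomorphic_on UNIV"
    using assms by (simp add: transcendental_entire_def)
  ultimately obtain a n where "\<And>z. f z = (\<Sum>i\<le>n. a i * z ^ i)"
    using pole_at_infinity by blast
  with assms show False
    using transcendental_entire_not_polyfun by blast
qed

text \<open>The fibre is closed by continuity, hence compact, and the zeros of the nonconstant
  function \<open>f z - w\<close> cannot accumulate.\<close>

lemma finite_fibre_if_bounded:
  assumes "f holomorphic_on UNIV" "\<not> f constant_on UNIV" "bounded {z. f z = w}"
  shows "finite {z. f z = w}"
proof -
  have "continuous_on UNIV f"
    using assms(1) by (rule holomorphic_on_imp_continuous_on)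
  then have "closed {z. f z = w}"
    by (intro closed_Collect_eq continuous_on_const)
  then have "compact {z. f z = w}"
    using assms(3) by (simp add: compact_eq_bounded_closed)
  moreover have "(\<lambda>z. f z - w) holomorphic_on UNIV"
    using assms(1) by (intro holomorphic_intros)
  moreover have "\<not> (\<lambda>z. f z - w) constant_on UNIV"
    using assms(2) by (auto simp: constant_on_def algebra_simps)
  ultimately have "finite {z \<in> {z. f z = w}. f z - w = 0}"
    by (intro holomorphic_compact_finite_zeros[where S = UNIV]) auto
  then show ?thesis by simp
qed

lemma Picard_exceptional_value_unique:
  assumes f: "transcendental_entire f"
    and v: "Picard_exceptional_value f v" and w: "Picard_exceptional_value f w"
  shows "v = w"
proof -
  \<comment> \<open>Inversion moves the essential singularity from infinity to 0. As
    \<open>inverse 0 = 0\<close>, the value \<open>h 0 = f 0\<close> is an artefact, so 0 is removed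
    below.\<close>
  define h where "h = f \<circ> inverse"
  have "f holomorphic_on UNIV"
    using f by (simp add: transcendental_entire_def)
  then have "h holomorphic_on UNIV - {0}"
    unfolding h_def
    by (intro holomorphic_on_compose holomorphic_intros) (auto intro: holomorphic_on_subset)
  moreover have "\<not> (h \<longlongrightarrow> l) (at 0)" for l
    using transcendental_entire_no_limit_at_infinity[OF f]
    by (simp add: h_def lim_at_infinity_0)
  moreover have "\<not> ((inverse \<circ> h) \<longlongrightarrow> l) (at 0)" for l
    using transcendental_entire_inverse_no_limit_at_infinity[OF f]
    by (simp add: h_def lim_at_infinity_0 comp_assoc)
  ultimately obtain a
    \<comment> \<open>By great Picard, \<open>a\<close> is the only value that \<open>h\<close> can
      take finitely often off 0.\<close>
    where a: "\<And>u. u \<noteq> a \<Longrightarrow> infinite {x. x \<in> UNIV - {0} \<and> h x = u}"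
    using great_Picard_infinite[of UNIV 0 h] by auto
  have "u = a" if "Picard_exceptional_value f u" for u
  proof (rule ccontr)
    assume "u \<noteq> a"
    \<comment> \<open>Each such \<open>x\<close> is the inverse of \<open>inverse x\<close>, a point
      of the fibre of \<open>f\<close>; a finite fibre of \<open>f\<close> thus forces a finite one
      of \<open>h\<close>.\<close>
    have "{x. x \<in> UNIV - {0} \<and> h x = u} \<subseteq> inverse ` {z. f z = u}"
      by (auto simp: h_def intro!: image_eqI[where x = "inverse _"])
    then show False
      using that a[OF \<open>u \<noteq> a\<close>] finite_subset
      unfolding Picard_exceptional_value_def by blast
  qed
  with v w show ?thesis by blast
qed

lemma CP_comp:
  assumes "f holomorphic_on UNIV" "g holomorphic_on UNIV"
  shows "CP (g \<circ> f) = CP f \<union> {z. f z \<in> CP g}"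
proof -
  have "deriv (g \<circ> f) z = deriv g (f z) * deriv f z" for z
    using assms by (intro deriv_chain) (auto intro: holomorphic_on_imp_differentiable_at)
  then show ?thesis
    by (auto simp: CP_def)
qed

theorem theorem2p7:
  fixes f g :: "complex \<Rightarrow> complex"
  assumes "transcendental_entire f"
    and "transcendental_entire g"
    and "bounded (CP (g \<circ> f))"
  shows "bounded (CP f) \<and>
         (\<forall>v\<in>CP g. \<forall>w\<in>CP g. v = w) \<and>
         (\<forall>w\<in>CP g. Picard_exceptional_value f w)"
proof -
  have hol: "f holomorphic_on UNIV" "g holomorphic_on UNIV"
    using assms by (simp_all add: transcendental_entire_def)
  have bdd: "bounded (CP f)" "bounded {z. f z \<in> CP g}"
    using assms(3) by (simp_all add: CP_comp[OF hol])
  have exceptional: "Picard_exceptional_value f w" if "w \<in> CP g" for w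
  proof -
    \<comment> \<open>The fibre over a single critical point of \<open>g\<close> lies inside the
      bounded preimage of \<open>CP g\<close>.\<close>
    have "bounded {z. f z = w}"
      using bdd(2) by (rule bounded_subset) (use that in auto)
    then show ?thesis
      using finite_fibre_if_bounded hol(1) transcendental_entire_not_constant[OF assms(1)]
      unfolding Picard_exceptional_value_def by blast
  qed
  then show ?thesis
    using bdd(1) Picard_exceptional_value_unique[OF assms(1)] by blast
qed

end
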